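(* For every integer $n\ge 1$ and every $f\in C^2[0,1]$, one has $$\left\|n\left(K_nf-f\right)-\tfrac12\left(Xf'\right)'\right\|_\infty\le \frac{2}{3(n+1)}\left(\frac34\|f'\|_\infty+\|f''\|_\infty\right)+\frac{9}{32}\left\{\frac{2}{\sqrt{n+1}}\,\omega_1\!\left(f'';\frac{1}{\sqrt{n+1}}\right)+\omega_2\!\left(f'';\frac{1}{\sqrt{n+1}}\right)\right\},$$ where $X=X(x)=x(1-x)$ and $X'=1-2x$, $x\in[0,1]$.
   Context: For $n\ge 1$, the classical Kantorovich operator is $$K_n(f;x)=(n+1)\sum_{k=0}^n p_{n,k}(x)\int_{k/(n+1)}^{(k+1)/(n+1)}f(t)\,dt,\qquad p_{n,k}(x)=\binom nk x^k(1-x)^{n-k},\quad x\in[0,1],$$ and $K_nf$ denotes the function $x\mapsto K_n(f;x)$. Functions are real-valued, and $\|\cdot\|_\infty$ is the supremum norm on $[0,1]$. For $g\in C[0,1]$, $k\in\mathbb N$ and $t\ge 0$, the classical $k$-th order modulus of smoothness is $$\omega_k(g;t)=\sup\left\{\left|\sum_{j=0}^k(-1)^{k-j}\binom kj g(x+j\delta)\right| : 0\le\delta\le t,\ x,\,x+k\delta\in[0,1]\right\}.$$ *)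

theory Defs
  imports "HOL-Analysis.Analysis"
begin

text \<open>
  Functions on the unit interval are represented by functions on the reals; every notion below
  depends only on their values on \<open>{0..1}\<close>. The derivative is taken within \<open>{0..1}\<close>, that is,
  one-sided at the two end points.
\<close>

definition deriv01 :: "(real \<Rightarrow> real) \<Rightarrow> real \<Rightarrow> real" where
  "deriv01 f x = vector_derivative f (at x within {0..1})"

definition C2_01 :: "(real \<Rightarrow> real) \<Rightarrow> bool" where
  "C2_01 f \<longleftrightarrow> f differentiable_on {0..1} \<and> deriv01 f differentiable_on {0..1}
     \<and> continuous_on {0..1} (deriv01 (deriv01 f))"

text \<open>
  The suprema below are taken in the reals, so they are meaningful only for functions that are
  bounded on \<open>{0..1}\<close>.
\<close>

definition sup_norm01 :: "(real \<Rightarrow> real) \<Rightarrow> real" where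
  "sup_norm01 g = (SUP x\<in>{0..1}. \<bar>g x\<bar>)"

definition modulus_of_smoothness :: "nat \<Rightarrow> (real \<Rightarrow> real) \<Rightarrow> real \<Rightarrow> real" where
  "modulus_of_smoothness k g t =
     Sup {\<bar>\<Sum>j\<le>k. (-1) ^ (k - j) * real (k choose j) * g (x + real j * \<delta>)\<bar> | x \<delta>.
       0 \<le> \<delta> \<and> \<delta> \<le> t \<and> x \<in> {0..1} \<and> x + real k * \<delta> \<in> {0..1}}"

definition kantorovich :: "nat \<Rightarrow> (real \<Rightarrow> real) \<Rightarrow> real \<Rightarrow> real" where
  "kantorovich n f x = (real n + 1) *
     (\<Sum>k\<le>n. Bernstein n k x * integral {real k / (real n + 1)..(real k + 1) / (real n + 1)} f)"

end

theory Submission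
  imports Defs
begin

text \<open>
  Write \<open>D = t - x\<close>, \<open>\<phi> = f''\<close>, \<open>N = n + 1\<close> and \<open>h = 1 / sqrt N\<close>, and let \<open>m\<^sub>j\<close> be the value
  at \<open>x\<close> of the operator on \<open>D ^ j\<close>. Replacing \<open>f\<close> by its second order Taylor polynomial at \<open>x\<close>
  leaves only the deviations of \<open>n * m\<^sub>1\<close> and \<open>n * m\<^sub>2\<close> from \<open>X' / 2\<close> and \<open>X\<close>, which are of order
  \<open>1 / N\<close>; these give the terms with \<open>f'\<close> and \<open>f''\<close>. The moduli come from the Taylor remainder.

  To keep the constants small, \<open>\<phi>\<close> is not smoothed globally. Instead, for each \<open>x\<close>, it is compared
  with one affine function, its secant through \<open>x\<close> and a point at distance \<open>\<eta> = min h (1/2)\<close>, whose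
  slope \<open>c\<close> is at most \<open>\<omega>\<^sub>1 / \<eta>\<close> in absolute value. A function that vanishes at both points and has
  second differences bounded by \<open>\<omega>\<^sub>2\<close> grows at most quadratically, which gives
  \<open>\<bar>\<phi> t - \<phi> x - c * D\<bar> \<le> 3/2 * \<omega>\<^sub>2 * (1 + 3 * D\<^sup>2 / \<eta>\<^sup>2)\<close>
  (\<open>affine_approximation_by_modulus\<close>). Integrating twice, \<open>f\<close> differs from its second order Taylor
  polynomial plus \<open>c / 6 * D ^ 3\<close> by at most \<open>3/4 * \<omega>\<^sub>2 * (D\<^sup>2 + D ^ 4 / (2 * \<eta>\<^sup>2))\<close>.

  So \<open>f\<close> lies between two quartic polynomials, and positivity of the operator reduces everything to
  its values on quartics, which are known exactly (\<open>kantorovich_quartic\<close>). The cubic term contributes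
  \<open>n * c * m\<^sub>3 / 6\<close>, which is of the smaller order \<open>h * \<omega>\<^sub>1\<close> because the odd moment \<open>m\<^sub>3\<close> nearly
  cancels. From \<open>n * m\<^sub>2 \<le> 1/4\<close> and \<open>n * m\<^sub>4 / \<eta>\<^sup>2 \<le> 1/4\<close> the remaining terms contribute at most
  \<open>3/4 * (1/4 + 1/8) * \<omega>\<^sub>2 = 9/32 * \<omega>\<^sub>2\<close>.
\<close>

section \<open>Functions with bounded second differences\<close>

text \<open>
  At a point \<open>r\<close> where \<open>\<bar>\<psi>\<bar>\<close> is maximal, reflect the nearer end point in \<open>r\<close>: one outer value of the
  second difference is zero and the other is at most \<open>\<bar>\<psi> r\<bar>\<close>, so \<open>2 * \<bar>\<psi> r\<bar> - \<bar>\<psi> r\<bar> \<le> w\<close>.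
\<close>

lemma abs_le_of_bounded_second_differences:
  fixes \<psi> :: "real \<Rightarrow> real"
  assumes cont: "continuous_on {a..b} \<psi>" and s: "s \<in> {a..b}"
    and za: "\<psi> a = 0" and zb: "\<psi> b = 0"
    and diff: "\<And>r d. 0 \<le> d \<Longrightarrow> a \<le> r - d \<Longrightarrow> r + d \<le> b
                 \<Longrightarrow> \<bar>\<psi> (r - d) - 2 * \<psi> r + \<psi> (r + d)\<bar> \<le> w"
  shows "\<bar>\<psi> s\<bar> \<le> w"
proof -
  have "continuous_on {a..b} (\<lambda>t. \<bar>\<psi> t\<bar>)"
    using cont by (intro continuous_intros)
  then obtain r where r: "r \<in> {a..b}" and max: "\<And>t. t \<in> {a..b} \<Longrightarrow> \<bar>\<psi> t\<bar> \<le> \<bar>\<psi> r\<bar>"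
    using continuous_attains_sup[of "{a..b}" "\<lambda>t. \<bar>\<psi> t\<bar>"] s by auto
  have "\<bar>\<psi> r\<bar> \<le> w"
  proof (cases "r - a \<le> b - r")
    case True
    then have "\<bar>\<psi> a - 2 * \<psi> r + \<psi> (2 * r - a)\<bar> \<le> w"
      using diff[of "r - a" r] r by (simp add: algebra_simps)
    moreover have "\<bar>\<psi> (2 * r - a)\<bar> \<le> \<bar>\<psi> r\<bar>"
      using max[of "2 * r - a"] True r by auto
    ultimately show ?thesis using za by linarith
  next
    case False
    then have "\<bar>\<psi> (2 * r - b) - 2 * \<psi> r + \<psi> b\<bar> \<le> w"
      using diff[of "b - r" r] r by (simp add: algebra_simps)
    moreover have "\<bar>\<psi> (2 * r - b)\<bar> \<le> \<bar>\<psi> r\<bar>"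
      using max[of "2 * r - b"] False r by auto
    ultimately show ?thesis using zb by linarith
  qed
  then show ?thesis using max[OF s] by linarith
qed

text \<open>
  For \<open>t < 0\<close> the previous lemma is applied on \<open>{t..1}\<close> to the deviation of \<open>\<psi>\<close> from its chord: at the
  interior point \<open>0\<close> the chord has the value \<open>\<psi> t / (1 - t)\<close> while \<open>\<psi>\<close> vanishes. The interval has
  length at most \<open>2\<close>, so steps of size at most \<open>1\<close> suffice.
\<close>

lemma abs_le_of_bounded_second_differences_near:
  fixes \<psi> :: "real \<Rightarrow> real"
  assumes J: "is_interval J" "0 \<in> J" "1 \<in> J" and cont: "continuous_on J \<psi>"
    and zero: "\<psi> 0 = 0" "\<psi> 1 = 0"
    and diff: "\<And>r d. 0 \<le> d \<Longrightarrow> d \<le> 1 \<Longrightarrow> r - d \<in> J \<Longrightarrow> r + d \<in> J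
                 \<Longrightarrow> \<bar>\<psi> (r - d) - 2 * \<psi> r + \<psi> (r + d)\<bar> \<le> w"
    and t: "t \<in> J" "\<bar>t\<bar> \<le> 1"
  shows "\<bar>\<psi> t\<bar> \<le> w * (1 + \<bar>t\<bar>)"
proof -
  have sub: "{min 0 t..1} \<subseteq> J"
  proof
    fix s assume "s \<in> {min 0 t..1}"
    moreover have "min 0 t \<in> J" using J t by (simp add: min_def)
    ultimately show "s \<in> J" using mem_is_interval_1_I[OF J(1) _ J(3)] by auto
  qed
  have w: "0 \<le> w" using diff[of 0 0] J by simp
  show ?thesis
  proof (cases "0 \<le> t")
    case True
    have "\<bar>\<psi> t\<bar> \<le> w"
    proof (rule abs_le_of_bounded_second_differences[of 0 1 \<psi> t])
      fix r d :: real assume "0 \<le> d" "0 \<le> r - d" "r + d \<le> 1"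
      then show "\<bar>\<psi> (r - d) - 2 * \<psi> r + \<psi> (r + d)\<bar> \<le> w"
        using True sub by (intro diff) auto
    qed (use True sub t zero continuous_on_subset[OF cont, of "{0..1}"] in auto)
    also have "w \<le> w * (1 + \<bar>t\<bar>)" using w by (simp add: algebra_simps)
    finally show ?thesis .
  next
    case False
    \<comment> \<open>The chord is \<open>s \<mapsto> c * (1 - s)\<close>.\<close>
    define c where "c = \<psi> t / (1 - t)"
    have "\<bar>\<psi> 0 - c * (1 - 0)\<bar> \<le> w"
    proof (rule abs_le_of_bounded_second_differences[of t 1 "\<lambda>s. \<psi> s - c * (1 - s)" 0])
      fix r d :: real assume rd: "0 \<le> d" "t \<le> r - d" "r + d \<le> 1"
      then have "\<bar>\<psi> (r - d) - 2 * \<psi> r + \<psi> (r + d)\<bar> \<le> w"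
        using False sub t by (intro diff) auto
      then show "\<bar>\<psi> (r - d) - c * (1 - (r - d)) - 2 * (\<psi> r - c * (1 - r))
                   + (\<psi> (r + d) - c * (1 - (r + d)))\<bar> \<le> w"
        by (simp add: algebra_simps)
    next
      show "continuous_on {t..1} (\<lambda>s. \<psi> s - c * (1 - s))"
        using False sub by (intro continuous_intros continuous_on_subset[OF cont]) auto
    qed (use False zero in \<open>auto simp: c_def\<close>)
    then have "\<bar>\<psi> t\<bar> / (1 - t) \<le> w"
      using False unfolding zero c_def by (simp add: abs_divide)
    then have "\<bar>\<psi> t\<bar> \<le> w * (1 - t)"
      using False by (simp only: pos_divide_le_eq)
    then show ?thesis using False by simp
  qed
qed

lemma abs_le_of_bounded_second_differences_sequence:
  fixes E :: "nat \<Rightarrow> real"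
  assumes E0: "E 0 = 0"
    and diff: "\<And>k. k + 2 \<le> m \<Longrightarrow> \<bar>E k - 2 * E (k + 1) + E (k + 2)\<bar> \<le> w"
  shows "\<bar>E m\<bar> \<le> real m * \<bar>E 1\<bar> + w * (real m * (real m - 1) / 2)"
proof -
  have step: "\<bar>E (k + 1) - E k\<bar> \<le> \<bar>E 1\<bar> + real k * w" if "k + 1 \<le> m" for k
    using that
  proof (induction k)
    case (Suc k)
    then show ?case using diff[of k] by (auto simp: algebra_simps)
  qed (simp add: E0)
  have "\<bar>E k\<bar> \<le> real k * \<bar>E 1\<bar> + w * (real k * (real k - 1) / 2)" if "k \<le> m" for k
    using that
  proof (induction k)
    case (Suc k)
    have eq: "real (Suc k) * \<bar>E 1\<bar> + w * (real (Suc k) * (real (Suc k) - 1) / 2)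
        = (real k * \<bar>E 1\<bar> + w * (real k * (real k - 1) / 2)) + (\<bar>E 1\<bar> + real k * w)"
      by (simp add: field_simps)
    show ?case unfolding eq using Suc step[of k] by auto
  qed (simp add: E0)
  then show ?thesis by simp
qed

text \<open>
  A point \<open>t\<close> is reached from \<open>0\<close> in \<open>m\<close> equal steps \<open>v = t / m\<close> of length at most \<open>1\<close>. The step is
  fitted to \<open>t\<close>, so all the points used lie between \<open>0\<close> and \<open>t\<close> and none leaves \<open>J\<close>.
  The first value \<open>\<psi> v\<close> is controlled by \<open>abs_le_of_bounded_second_differences_near\<close>, and summing
  the second differences twice gives the quadratic growth.
\<close>

lemma abs_le_quadratic_of_bounded_second_differences:
  fixes \<psi> :: "real \<Rightarrow> real"
  assumes J: "is_interval J" "0 \<in> J" "1 \<in> J" and cont: "continuous_on J \<psi>"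
    and zero: "\<psi> 0 = 0" "\<psi> 1 = 0"
    and diff: "\<And>r d. 0 \<le> d \<Longrightarrow> d \<le> 1 \<Longrightarrow> r - d \<in> J \<Longrightarrow> r + d \<in> J
                 \<Longrightarrow> \<bar>\<psi> (r - d) - 2 * \<psi> r + \<psi> (r + d)\<bar> \<le> w"
    and t: "t \<in> J"
  shows "\<bar>\<psi> t\<bar> \<le> 3 / 2 * w * (1 + 3 * t\<^sup>2)"
proof -
  have w: "0 \<le> w" using diff[of 0 0] J by simp
  define m where "m = nat \<lfloor>\<bar>t\<bar>\<rfloor> + 1"
  have m: "\<bar>t\<bar> \<le> real m" "real m \<le> \<bar>t\<bar> + 1" "1 \<le> m"
    unfolding m_def by linarith+
  define v where "v = t / real m"
  have mv: "real m * v = t" using m by (simp add: v_def)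
  have mv_abs: "real m * \<bar>v\<bar> = \<bar>t\<bar>" using m by (simp add: v_def)
  have v1: "\<bar>v\<bar> \<le> 1" using m by (simp add: v_def abs_div)
  have inJ: "real k * v \<in> J" if "k \<le> m" for k
  proof -
    define \<theta> where "\<theta> = real k / real m"
    have \<theta>: "0 \<le> \<theta>" "\<theta> \<le> 1" using that m by (auto simp: \<theta>_def)
    have "real k * v = (1 - \<theta>) *\<^sub>R 0 + \<theta> *\<^sub>R t" by (simp add: v_def \<theta>_def)
    then show ?thesis
      using convexD_alt[of J 0 t \<theta>] J(1,2) t \<theta> by (simp add: is_interval_convex)
  qed
  have near: "\<bar>\<psi> v\<bar> \<le> w * (1 + \<bar>v\<bar>)"
    using abs_le_of_bounded_second_differences_near[OF J cont zero diff] inJ[of 1] v1 m by simp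
  have "\<bar>\<psi> (real m * v)\<bar> \<le> real m * \<bar>\<psi> (real 1 * v)\<bar> + w * (real m * (real m - 1) / 2)"
  proof (rule abs_le_of_bounded_second_differences_sequence[of "\<lambda>k. \<psi> (real k * v)"])
    fix k assume k: "k + 2 \<le> m"
    define r where "r = real (k + 1) * v"
    have r: "real k * v = r - v" "real (k + 2) * v = r + v"
      by (simp_all add: r_def algebra_simps)
    have "r - v \<in> J" "r + v \<in> J"
      using inJ[of k] inJ[of "k + 2"] k unfolding r by simp_all
    then have "\<bar>\<psi> (r - v) - 2 * \<psi> r + \<psi> (r + v)\<bar> \<le> w"
      using diff[of v r] diff[of "- v" r] v1 by (cases "0 \<le> v") simp_all
    then show "\<bar>\<psi> (real k * v) - 2 * \<psi> (real (k + 1) * v) + \<psi> (real (k + 2) * v)\<bar> \<le> w"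
      unfolding r r_def[symmetric] .
  qed (simp add: zero)
  also have "\<dots> \<le> real m * (w * (1 + \<bar>v\<bar>)) + w * (real m * (real m - 1) / 2)"
    using near by (simp add: mult_left_mono)
  also have "\<dots> = w * (real m * \<bar>v\<bar> + real m * (real m + 1) / 2)"
    by (simp add: field_simps)
  also have "\<dots> = w * (\<bar>t\<bar> + real m * (real m + 1) / 2)"
    by (simp only: mv_abs)
  also have "\<dots> \<le> w * (\<bar>t\<bar> + (\<bar>t\<bar> + 1) * (\<bar>t\<bar> + 1 + 1) / 2)"
    using m w by (intro mult_left_mono add_mono divide_right_mono mult_mono) auto
  also have "\<dots> \<le> w * (3 / 2 * (1 + 3 * t\<^sup>2))"
  proof (rule mult_left_mono[OF _ w])
    \<comment> \<open>Completing the square in \<open>4 * s\<^sup>2 - 5/2 * s + 1/2 \<ge> 0\<close>.\<close>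
    have "0 \<le> (2 * s - 5 / 8)\<^sup>2 \<Longrightarrow> s + (s + 1) * (s + 1 + 1) / 2 \<le> 3 / 2 * (1 + 3 * s\<^sup>2)"
      for s :: real
      by (simp add: power2_eq_square field_simps)
    from this[of "\<bar>t\<bar>"]
    show "\<bar>t\<bar> + (\<bar>t\<bar> + 1) * (\<bar>t\<bar> + 1 + 1) / 2 \<le> 3 / 2 * (1 + 3 * t\<^sup>2)"
      by simp
  qed
  also have "\<dots> = 3 / 2 * w * (1 + 3 * t\<^sup>2)"
    by simp
  finally show ?thesis unfolding mv .
qed

section \<open>The Kantorovich operator on quartic polynomials\<close>

text \<open>
  Condition a binomial variable on its last trial.
\<close>

lemma sum_Bernstein_Suc:
  "(\<Sum>k\<le>Suc n. Bernstein (Suc n) k x * g k)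
     = (\<Sum>k\<le>n. Bernstein n k x * ((1 - x) * g k + x * g (Suc k)))"
proof -
  have rec: "Bernstein (Suc n) (Suc k) x = x * Bernstein n k x + (1 - x) * Bernstein n (Suc k) x"
    for k
  proof (cases "k < n")
    case True
    then have "n - k = Suc (n - Suc k)" by simp
    then show ?thesis by (simp add: Bernstein_def algebra_simps)
  next
    case False
    then show ?thesis by (simp add: Bernstein_def binomial_eq_0)
  qed
  have "(\<Sum>k\<le>Suc n. Bernstein (Suc n) k x * g k)
      = Bernstein (Suc n) 0 x * g 0 + (\<Sum>k\<le>n. Bernstein (Suc n) (Suc k) x * g (Suc k))"
    by (rule sum.atMost_Suc_shift)
  also have "\<dots> = (1 - x) * (Bernstein n 0 x * g 0 + (\<Sum>k\<le>n. Bernstein n (Suc k) x * g (Suc k)))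
      + (\<Sum>k\<le>n. Bernstein n k x * (x * g (Suc k)))"
    by (simp add: rec Bernstein_def[of _ 0] algebra_simps sum.distrib sum_distrib_left
        sum_subtractf)
  also have "Bernstein n 0 x * g 0 + (\<Sum>k\<le>n. Bernstein n (Suc k) x * g (Suc k))
      = (\<Sum>k\<le>Suc n. Bernstein n k x * g k)"
    by (rule sum.atMost_Suc_shift[symmetric])
  also have "\<dots> = (\<Sum>k\<le>n. Bernstein n k x * g k)"
    by (simp add: Bernstein_def)
  finally show ?thesis
    by (simp add: sum_distrib_left sum.distrib sum_subtractf algebra_simps)
qed

text \<open>
  The central moments up to order four of the binomial distribution. The recurrence turns a quartic
  polynomial for \<open>n + 1\<close> into one for \<open>n\<close>, so with arbitrary coefficients the induction
  proves all the moment formulas simultaneously.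
\<close>

lemma sum_Bernstein_quartic:
  fixes x a b c d e :: real
  defines "X \<equiv> x * (1 - x)"
  shows "(\<Sum>k\<le>n. Bernstein n k x * (a + b * (real k - real n * x) + c * (real k - real n * x)^2
            + d * (real k - real n * x)^3 + e * (real k - real n * x)^4))
     = a + c * (real n * X) + d * (real n * X * (1 - 2 * x))
         + e * (3 * (real n * X)\<^sup>2 + real n * X * (1 - 6 * X))"
proof (induction n arbitrary: a b c d e)
  case 0
  show ?case by (simp add: Bernstein_def)
next
  case (Suc n)
  define y where "y k = real k - real n * x" for k
  \<comment> \<open>The coefficients after averaging over the last trial.\<close>
  define a' where "a' = a + c * X + d * (X * (1 - 2 * x)) + e * (X * (1 - 3 * X))"
  define b' where "b' = b + 3 * d * X + 4 * e * (X * (1 - 2 * x))"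
  define c' where "c' = c + 6 * e * X"
  have y: "real k - real (Suc n) * x = y k - x" "real (Suc k) - real (Suc n) * x = y k + 1 - x" for k
    by (simp_all add: y_def algebra_simps)
  have avg: "(1 - x) * (a + b * (s - x) + c * (s - x)^2 + d * (s - x)^3 + e * (s - x)^4)
      + x * (a + b * (s + 1 - x) + c * (s + 1 - x)^2 + d * (s + 1 - x)^3 + e * (s + 1 - x)^4)
      = a' + b' * s + c' * s^2 + d * s^3 + e * s^4" for s
    unfolding a'_def b'_def c'_def X_def by algebra
  show ?case
    unfolding sum_Bernstein_Suc y(2) unfolding y(1) avg
    unfolding y_def Suc.IH
    unfolding a'_def c'_def by (simp add: power2_eq_square algebra_simps)
qed

lemma kantorovich_cell_quartic:
  fixes x a b c d e :: real and k n :: nat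
  defines "N \<equiv> real n + 1" and "s \<equiv> real k - real n * x - x"
  shows "N * integral {real k / N..(real k + 1) / N}
            (\<lambda>t. a + b * (t - x) + c * (t - x)^2 + d * (t - x)^3 + e * (t - x)^4)
     = a + b / N * (s + 1/2) + c / N^2 * (s^2 + s + 1/3) + d / N^3 * (s^3 + 3/2 * s^2 + s + 1/4)
         + e / N^4 * (s^4 + 2 * s^3 + 2 * s^2 + s + 1/5)"
proof -
  define F where "F t = a * (t - x) + b * (t - x)^2 / 2 + c * (t - x)^3 / 3 + d * (t - x)^4 / 4
      + e * (t - x)^5 / 5" for t
  have N: "N > 0" by (simp add: N_def)
  have "((\<lambda>t. a + b * (t - x) + c * (t - x)^2 + d * (t - x)^3 + e * (t - x)^4) has_integral
      F ((real k + 1) / N) - F (real k / N)) {real k / N..(real k + 1) / N}"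
  proof (rule fundamental_theorem_of_calculus)
    show "real k / N \<le> (real k + 1) / N" using N by (simp add: divide_right_mono)
    show "(F has_vector_derivative a + b * (t - x) + c * (t - x)^2 + d * (t - x)^3 + e * (t - x)^4)
        (at t within {real k / N..(real k + 1) / N})" for t
      unfolding F_def has_real_derivative_iff_has_vector_derivative[symmetric]
      by (auto intro!: derivative_eq_intros simp: field_simps)
  qed
  then have int: "integral {real k / N..(real k + 1) / N}
      (\<lambda>t. a + b * (t - x) + c * (t - x)^2 + d * (t - x)^3 + e * (t - x)^4)
      = F ((real k + 1) / N) - F (real k / N)" by (rule integral_unique)
  define M where "M = 1 / N"
  have NM: "N * M = 1" using N by (simp add: M_def)
  have lo: "real k / N - x = s * M" and hi: "(real k + 1) / N - x = (s + 1) * M"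
    using N by (simp_all add: M_def s_def N_def field_simps)
  have M: "b / N = b * M" "c / N^2 = c * M^2" "d / N^3 = d * M^3" "e / N^4 = e * M^4"
    by (simp_all add: M_def power_one_over)
  have cancel: "N * (M * q) = q" for q using NM by (simp flip: mult.assoc)
  have "F ((real k + 1) / N) - F (real k / N)
      = M * (a + b / N * (s + 1/2) + c / N^2 * (s^2 + s + 1/3)
          + d / N^3 * (s^3 + 3/2 * s^2 + s + 1/4) + e / N^4 * (s^4 + 2 * s^3 + 2 * s^2 + s + 1/5))"
    unfolding F_def lo hi M by (simp add: eval_nat_numeral field_simps)
  then show ?thesis unfolding int by (simp only: cancel)
qed

text \<open>
  After averaging over a cell, the quartic in \<open>t - x\<close> becomes a quartic in \<open>k - n * x\<close>, with
  coefficients \<open>A\<close>, \<open>B\<close>, \<open>C\<close>, \<open>D\<close>, \<open>e'\<close>, to which the binomial moment formula applies.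
\<close>

lemma kantorovich_quartic:
  fixes x a b c d e :: real and n :: nat
  defines "X \<equiv> x * (1 - x)" and "N \<equiv> real n + 1"
  shows "kantorovich n
            (\<lambda>t. a + b * (t - x) + c * (t - x)^2 + d * (t - x)^3 + e * (t - x)^4) x
     = a + b * ((1 - 2 * x) / (2 * N)) + c * (((real n - 1) * X + 1/3) / N^2)
         + d * ((1 - 2 * x) * (5/2 * real n * X + 1/4 - X/2) / N^3)
         + e * ((3 * (real n * X)\<^sup>2 + 5 * real n * X * (1 - 4 * X) + 1/5 - X + X\<^sup>2) / N^4)"
proof -
  define b' c' d' e' where "b' = b / N" and "c' = c / N^2" and "d' = d / N^3" and "e' = e / N^4"
  define A where "A = a + b' * (1/2 - x) + c' * (x^2 - x + 1/3) + d' * (3/2 * x^2 - x^3 - x + 1/4)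
      + e' * (x^4 - 2 * x^3 + 2 * x^2 - x + 1/5)"
  define B where "B = b' + c' * (1 - 2 * x) + d' * (3 * x^2 - 3 * x + 1)
      + e' * (6 * x^2 - 4 * x^3 - 4 * x + 1)"
  define C where "C = c' + d' * (3/2 - 3 * x) + e' * (6 * x^2 - 6 * x + 2)"
  define D where "D = d' + e' * (2 - 4 * x)"
  have shift: "a + b' * (y - x + 1/2) + c' * ((y - x)^2 + (y - x) + 1/3)
      + d' * ((y - x)^3 + 3/2 * (y - x)^2 + (y - x) + 1/4)
      + e' * ((y - x)^4 + 2 * (y - x)^3 + 2 * (y - x)^2 + (y - x) + 1/5)
      = A + B * y + C * y^2 + D * y^3 + e' * y^4" for y
    unfolding A_def B_def C_def D_def by (simp add: eval_nat_numeral field_simps)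
  have "kantorovich n
            (\<lambda>t. a + b * (t - x) + c * (t - x)^2 + d * (t - x)^3 + e * (t - x)^4) x
     = (\<Sum>k\<le>n. Bernstein n k x * (N * integral {real k / N..(real k + 1) / N}
            (\<lambda>t. a + b * (t - x) + c * (t - x)^2 + d * (t - x)^3 + e * (t - x)^4)))"
    by (simp add: kantorovich_def N_def sum_distrib_left mult_ac)
  also have "\<dots> = (\<Sum>k\<le>n. Bernstein n k x * (A + B * (real k - real n * x)
      + C * (real k - real n * x)^2 + D * (real k - real n * x)^3 + e' * (real k - real n * x)^4))"
    unfolding N_def kantorovich_cell_quartic
    unfolding shift[symmetric] unfolding b'_def c'_def d'_def e'_def N_def ..
  also have "\<dots> = A + C * (real n * X) + D * (real n * X * (1 - 2 * x))
         + e' * (3 * (real n * X)\<^sup>2 + real n * X * (1 - 6 * X))"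
    unfolding X_def by (rule sum_Bernstein_quartic)
  also have "\<dots> = a + b' * ((1 - 2 * x) / 2) + c' * ((real n - 1) * X + 1/3)
         + d' * ((1 - 2 * x) * (5/2 * real n * X + 1/4 - X/2))
         + e' * (3 * (real n * X)\<^sup>2 + 5 * real n * X * (1 - 4 * X) + 1/5 - X + X\<^sup>2)"
    unfolding A_def B_def C_def D_def X_def by (simp add: eval_nat_numeral field_simps)
  finally show ?thesis by (simp add: b'_def c'_def d'_def e'_def mult_ac)
qed

lemma kantorovich_mono:
  assumes "continuous_on {0..1} f" "continuous_on {0..1} g"
    and "\<And>t. t \<in> {0..1} \<Longrightarrow> f t \<le> g t" and "x \<in> {0..1}"
  shows "kantorovich n f x \<le> kantorovich n g x"
  unfolding kantorovich_def
proof (intro mult_left_mono sum_mono)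
  fix k assume "k \<in> {..n}"
  then have "0 \<le> real k / (real n + 1)" "(real k + 1) / (real n + 1) \<le> 1" by auto
  then have sub: "{real k / (real n + 1)..(real k + 1) / (real n + 1)} \<subseteq> {0..1}"
    unfolding atLeastatMost_subset_iff by blast
  show "integral {real k / (real n + 1)..(real k + 1) / (real n + 1)} f
      \<le> integral {real k / (real n + 1)..(real k + 1) / (real n + 1)} g"
    by (intro integral_le integrable_continuous_interval continuous_on_subset[OF _ sub] assms)
      (use sub in blast)
  show "0 \<le> Bernstein n k x" using assms by (auto intro: Bernstein_nonneg)
qed simp

text \<open>
  The expressions bounded here are \<open>n\<close> times the second, third and fourth moment from
  \<open>kantorovich_quartic\<close>; they all follow from \<open>0 \<le> X \<le> 1/4\<close> and \<open>\<bar>1 - 2 * x\<bar> \<le> 1\<close>. The first and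
  the last bound determine the constant \<open>9/32\<close>.
\<close>

lemma kantorovich_moment_bounds:
  fixes x :: real and n :: nat
  defines "X \<equiv> x * (1 - x)" and "N \<equiv> real n + 1"
  assumes x: "x \<in> {0..1}"
  shows "real n * (((real n - 1) * X + 1/3) / N^2) \<le> 1/4"
    and "\<bar>real n * (((real n - 1) * X + 1/3) / N^2) - X\<bar> \<le> 1 / N"
    and "\<bar>real n * ((1 - 2 * x) * (5/2 * real n * X + 1/4 - X/2) / N^3)\<bar> \<le> 1 / N"
    and "real n * ((3 * (real n * X)\<^sup>2 + 5 * real n * X * (1 - 4 * X) + 1/5 - X + X\<^sup>2) / N^4)
           \<le> real n / (4 * N^2)"
proof -
  have N: "N > 0" "real n \<le> N" and n: "0 \<le> real n" by (auto simp: N_def)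
  have X0: "0 \<le> X" using x by (simp add: X_def)
  have X4: "X \<le> 1/4"
    using zero_le_power2[of "1 - 2 * x"] by (simp add: X_def power2_eq_square algebra_simps)
  have nX0: "0 \<le> real n * X" and nX4: "real n * X \<le> real n / 4"
    using X0 X4 n mult_left_mono[OF X4 n] by auto
  have n2: "real n \<le> (real n)\<^sup>2"
    by (cases n) (auto simp: power2_eq_square)
  have m2: "(real n - 1) * X + 1/3 \<le> real n / 4 + 1/3"
    using X0 nX4 by (simp add: algebra_simps)
  have "real n * ((real n - 1) * X + 1/3) \<le> real n * (real n / 4 + 1/3)"
    using m2 n by (rule mult_left_mono)
  also have "\<dots> \<le> N^2 / 4"
    using n2 n by (simp add: N_def power2_eq_square algebra_simps)
  finally show "real n * (((real n - 1) * X + 1/3) / N^2) \<le> 1/4"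
    using N by (simp add: divide_le_eq)
  have "real n * (((real n - 1) * X + 1/3) / N^2) - X = (real n / 3 - 3 * (real n * X) - X) / N^2"
    using N(1) by (simp add: field_simps) (simp add: N_def power2_eq_square algebra_simps)
  also have "\<bar>\<dots>\<bar> \<le> N / N^2"
  proof -
    have "\<bar>real n / 3 - 3 * (real n * X) - X\<bar> \<le> N"
      using X0 X4 nX0 nX4 n unfolding abs_le_iff N_def by (intro conjI; linarith)
    then show ?thesis by (simp add: abs_divide divide_right_mono)
  qed
  also have "N / N^2 = 1 / N" using N by (simp add: power2_eq_square)
  finally show "\<bar>real n * (((real n - 1) * X + 1/3) / N^2) - X\<bar> \<le> 1 / N" .
  have "\<bar>(1 - 2 * x) * (5/2 * real n * X + 1/4 - X/2)\<bar> \<le> 1 * N"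
    unfolding abs_mult
  proof (rule mult_mono)
    show "\<bar>5/2 * real n * X + 1/4 - X/2\<bar> \<le> N"
      using X0 X4 nX0 nX4 n unfolding abs_le_iff N_def by (intro conjI; linarith)
  qed (use x in \<open>auto simp: abs_le_iff\<close>)
  then have "\<bar>real n * ((1 - 2 * x) * (5/2 * real n * X + 1/4 - X/2) / N^3)\<bar> \<le> N * N / N^3"
    using n N by (auto simp: abs_mult intro!: divide_right_mono mult_mono)
  also have "N * N / N^3 = 1 / N" using N by (simp add: power3_eq_cube)
  finally show "\<bar>real n * ((1 - 2 * x) * (5/2 * real n * X + 1/4 - X/2) / N^3)\<bar> \<le> 1 / N" .
  have "(real n * X)\<^sup>2 \<le> (real n / 4)\<^sup>2"
    using nX0 nX4 by (rule power_mono[rotated])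
  moreover have "5 * real n * X * (1 - 4 * X) \<le> 5 * real n / 16"
  proof -
    have "X * (1 - 4 * X) \<le> 1/16"
      using zero_le_power2[of "1 - 8 * X"] by (simp add: power2_eq_square algebra_simps)
    from mult_left_mono[OF this, of "5 * real n"] show ?thesis by (simp add: mult_ac)
  qed
  moreover have "X\<^sup>2 \<le> X"
    using X0 X4 by (simp add: power2_eq_square mult_left_le)
  ultimately have *: "3 * (real n * X)\<^sup>2 + 5 * real n * X * (1 - 4 * X) + 1/5 - X + X\<^sup>2
      \<le> 3 * (real n / 4)\<^sup>2 + 5 * real n / 16 + 1/5"
    by linarith
  have "3 * (real n * X)\<^sup>2 + 5 * real n * X * (1 - 4 * X) + 1/5 - X + X\<^sup>2 \<le> N^2 / 4"
  proof -
    have "N\<^sup>2 / 4 = (real n)\<^sup>2 / 4 + real n / 2 + 1 / 4"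
      by (simp add: N_def power2_eq_square field_simps)
    moreover have "(real n / 4)\<^sup>2 = (real n)\<^sup>2 / 16"
      by (simp add: power_divide)
    moreover have "0 \<le> (real n)\<^sup>2" by simp
    ultimately show ?thesis using n * by linarith
  qed
  then have "(3 * (real n * X)\<^sup>2 + 5 * real n * X * (1 - 4 * X) + 1/5 - X + X\<^sup>2) / N^4
      \<le> (N^2 / 4) / N^4"
    by (rule divide_right_mono) (use N in simp)
  also have "\<dots> = 1 / (4 * N^2)"
    using N by (simp add: eval_nat_numeral)
  finally show "real n * ((3 * (real n * X)\<^sup>2 + 5 * real n * X * (1 - 4 * X) + 1/5 - X + X\<^sup>2) / N^4)
           \<le> real n / (4 * N^2)"
    using mult_left_mono[OF _ n] by fastforce
qed

section \<open>Derivatives, suprema and moduli on the unit interval\<close>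

lemma deriv01_eqI:
  assumes "(f has_real_derivative d) (at x within {0..1})" "x \<in> {0..1}"
  shows "deriv01 f x = d"
  using vector_derivative_within_cbox[of 0 1 x f d] assms
  by (simp add: deriv01_def has_real_derivative_iff_has_vector_derivative)

lemma has_real_derivative_deriv01:
  assumes "f differentiable_on {0..1}" "x \<in> {0..1}"
  shows "(f has_real_derivative deriv01 f x) (at x within {0..1})"
  using assms vector_derivative_works[of f "at x within {0..1}"]
  by (simp add: deriv01_def differentiable_on_def has_real_derivative_iff_has_vector_derivative)

lemma abs_le_sup_norm01:
  assumes "continuous_on {0..1} g" "x \<in> {0..1}"
  shows "\<bar>g x\<bar> \<le> sup_norm01 g"
  unfolding sup_norm01_def
proof (rule cSUP_upper)
  have "compact ((\<lambda>x. \<bar>g x\<bar>) ` {0..1})"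
    using assms(1) by (intro compact_continuous_image continuous_intros) auto
  then show "bdd_above ((\<lambda>x. \<bar>g x\<bar>) ` {0..1})"
    by (intro bounded_imp_bdd_above compact_imp_bounded)
qed (fact assms)

lemma le_modulus_of_smoothness:
  assumes cont: "continuous_on {0..1} g"
    and "0 \<le> \<delta>" "\<delta> \<le> t" "x \<in> {0..1}" "x + real k * \<delta> \<in> {0..1}"
  shows "\<bar>\<Sum>j\<le>k. (-1) ^ (k - j) * real (k choose j) * g (x + real j * \<delta>)\<bar>
           \<le> modulus_of_smoothness k g t"
  unfolding modulus_of_smoothness_def
proof (rule cSup_upper)
  show "bdd_above {\<bar>\<Sum>j\<le>k. (-1) ^ (k - j) * real (k choose j) * g (x + real j * \<delta>)\<bar> | x \<delta>.
       0 \<le> \<delta> \<and> \<delta> \<le> t \<and> x \<in> {0..1} \<and> x + real k * \<delta> \<in> {0..1}}"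
  proof (rule bdd_aboveI, safe)
    fix x \<delta> assume *: "0 \<le> \<delta>" "x \<in> {0..1}" "x + real k * \<delta> \<in> {0..1}"
    show "\<bar>\<Sum>j\<le>k. (-1) ^ (k - j) * real (k choose j) * g (x + real j * \<delta>)\<bar>
        \<le> (\<Sum>j\<le>k. real (k choose j) * sup_norm01 g)"
    proof (rule order_trans[OF sum_abs], rule sum_mono)
      fix j assume "j \<in> {..k}"
      then have "real j * \<delta> \<le> real k * \<delta>" using * by (intro mult_right_mono) auto
      then have "\<bar>g (x + real j * \<delta>)\<bar> \<le> sup_norm01 g"
        using * by (intro abs_le_sup_norm01 cont) auto
      then show "\<bar>(-1) ^ (k - j) * real (k choose j) * g (x + real j * \<delta>)\<bar>
          \<le> real (k choose j) * sup_norm01 g"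
        by (simp add: abs_mult power_abs mult_left_mono)
    qed
  qed
qed (use assms in blast)

lemma first_difference_le_modulus:
  assumes "continuous_on {0..1} g" "x \<in> {0..1}" "y \<in> {0..1}" "\<bar>y - x\<bar> \<le> t"
  shows "\<bar>g y - g x\<bar> \<le> modulus_of_smoothness 1 g t"
proof -
  have le: "\<bar>g v - g u\<bar> \<le> modulus_of_smoothness 1 g t"
    if "u \<in> {0..1}" "v \<in> {0..1}" "u \<le> v" "v - u \<le> t" for u v
    using le_modulus_of_smoothness[OF assms(1), of "v - u" t u 1] that by simp
  show ?thesis using le[of x y] le[of y x] assms by (cases "x \<le> y") auto
qed

lemma second_difference_le_modulus:
  assumes "continuous_on {0..1} g" "x - s \<in> {0..1}" "x + s \<in> {0..1}" "\<bar>s\<bar> \<le> t"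
  shows "\<bar>g (x - s) - 2 * g x + g (x + s)\<bar> \<le> modulus_of_smoothness 2 g t"
proof -
  have le: "\<bar>g (x - s) - 2 * g x + g (x + s)\<bar> \<le> modulus_of_smoothness 2 g t"
    if "x - s \<in> {0..1}" "x + s \<in> {0..1}" "0 \<le> s" "s \<le> t" for s
    using le_modulus_of_smoothness[OF assms(1), of s t "x - s" 2] that
    by (simp add: eval_nat_numeral atMost_Suc algebra_simps)
  show ?thesis using le[of s] le[of "- s"] assms by (cases "0 \<le> s") auto
qed

text \<open>
  The affine function is the secant of \<open>\<phi>\<close> through \<open>x\<close> and \<open>x + a\<close>, where \<open>a = \<eta>\<close> or \<open>a = - \<eta>\<close>
  according to which direction stays in \<open>{0..1}\<close>; this is why \<open>\<eta> \<le> 1/2\<close> is required. In the variable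
  \<open>u = (t - x) / a\<close> the deviation from the secant vanishes at \<open>0\<close> and \<open>1\<close>.
\<close>

lemma affine_approximation_by_modulus:
  assumes cont: "continuous_on {0..1} \<phi>" and x: "x \<in> {0..1}"
    and \<eta>: "0 < \<eta>" "\<eta> \<le> 1/2" "\<eta> \<le> h"
  obtains c where "\<bar>c\<bar> \<le> modulus_of_smoothness 1 \<phi> h / \<eta>"
    and "\<And>t. t \<in> {0..1} \<Longrightarrow> \<bar>\<phi> t - \<phi> x - c * (t - x)\<bar>
           \<le> 3 / 2 * modulus_of_smoothness 2 \<phi> h * (1 + 3 * (t - x)\<^sup>2 / \<eta>\<^sup>2)"
proof -
  define a where "a = (if x \<le> 1/2 then \<eta> else - \<eta>)"
  have a: "a \<noteq> 0" "\<bar>a\<bar> = \<eta>" "x + a \<in> {0..1}" using x \<eta> by (auto simp: a_def)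
  define c where "c = (\<phi> (x + a) - \<phi> x) / a"
  define J where "J = {u. x + u * a \<in> {0..1}}"
  define \<psi> where "\<psi> u = \<phi> (x + u * a) - \<phi> x - c * (u * a)" for u
  have "\<bar>c\<bar> \<le> modulus_of_smoothness 1 \<phi> h / \<eta>"
    using first_difference_le_modulus[OF cont x a(3), of h] a \<eta>
    by (simp add: c_def divide_right_mono)
  moreover have "\<bar>\<phi> t - \<phi> x - c * (t - x)\<bar>
           \<le> 3 / 2 * modulus_of_smoothness 2 \<phi> h * (1 + 3 * (t - x)\<^sup>2 / \<eta>\<^sup>2)"
    if t: "t \<in> {0..1}" for t
  proof -
    have "\<bar>\<psi> ((t - x) / a)\<bar>
        \<le> 3 / 2 * modulus_of_smoothness 2 \<phi> h * (1 + 3 * ((t - x) / a)\<^sup>2)"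
    proof (rule abs_le_quadratic_of_bounded_second_differences)
      have "convex J"
        unfolding J_def convex_alt
      proof (intro ballI allI impI)
        fix u v \<theta> :: real
        assume "u \<in> {u. x + u * a \<in> {0..1}}" "v \<in> {u. x + u * a \<in> {0..1}}" "0 \<le> \<theta> \<and> \<theta> \<le> 1"
        then have "(1 - \<theta>) *\<^sub>R (x + u * a) + \<theta> *\<^sub>R (x + v * a) \<in> {0..1}"
          by (intro convexD_alt) auto
        then show "(1 - \<theta>) *\<^sub>R u + \<theta> *\<^sub>R v \<in> {u. x + u * a \<in> {0..1}}"
          by (simp add: algebra_simps)
      qed
      then show "is_interval J" by (simp add: is_interval_convex_1)
      show "0 \<in> J" "1 \<in> J" "(t - x) / a \<in> J" using x a t by (auto simp: J_def)
      have "continuous_on J (\<lambda>u. \<phi> (x + u * a))"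
        by (rule continuous_on_compose2[OF cont]) (auto simp: J_def intro!: continuous_intros)
      then show "continuous_on J \<psi>" unfolding \<psi>_def by (intro continuous_intros)
      show "\<psi> 0 = 0" "\<psi> 1 = 0" using a by (auto simp: \<psi>_def c_def)
    next
      fix r d :: real assume *: "0 \<le> d" "d \<le> 1" "r - d \<in> J" "r + d \<in> J"
      have "d * \<eta> \<le> h" using mult_right_mono[of d 1 \<eta>] * \<eta> by linarith
      then have "\<bar>d * a\<bar> \<le> h" using * a(2) by (simp add: abs_mult)
      then have "\<bar>\<phi> (x + r * a - d * a) - 2 * \<phi> (x + r * a) + \<phi> (x + r * a + d * a)\<bar>
          \<le> modulus_of_smoothness 2 \<phi> h"
        using *
        by (intro second_difference_le_modulus[OF cont]) (auto simp: J_def algebra_simps)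
      then show "\<bar>\<psi> (r - d) - 2 * \<psi> r + \<psi> (r + d)\<bar> \<le> modulus_of_smoothness 2 \<phi> h"
        by (simp add: \<psi>_def algebra_simps)
    qed
    moreover have "a\<^sup>2 = \<eta>\<^sup>2" using a by (metis power2_abs)
    ultimately show ?thesis using a by (simp add: \<psi>_def power_divide)
  qed
  ultimately show ?thesis by (rule that)
qed

section \<open>The Taylor remainder\<close>

text \<open>
  The mean value theorem applied to \<open>G'\<close> shows that \<open>G'\<close> has the sign of \<open>t - x\<close>; applied
  to \<open>G\<close> it then shows that \<open>G\<close> has its minimum at \<open>x\<close>.
\<close>

lemma nonneg_of_second_derivative_nonneg:
  fixes G :: "real \<Rightarrow> real"
  assumes G: "\<And>t. t \<in> {0..1} \<Longrightarrow> (G has_real_derivative G' t) (at t within {0..1})"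
    and G': "\<And>t. t \<in> {0..1} \<Longrightarrow> (G' has_real_derivative G'' t) (at t within {0..1})"
    and nonneg: "\<And>t. t \<in> {0..1} \<Longrightarrow> 0 \<le> G'' t"
    and x: "x \<in> {0..1}" "G x = 0" "G' x = 0" and t: "t \<in> {0..1}"
  shows "0 \<le> G t"
proof -
  have mvt: "\<exists>\<xi>\<in>{a..b}. F b - F a = F' \<xi> * (b - a)"
    if "a \<le> b" "a \<in> {0..1}" "b \<in> {0..1}"
      and F: "\<And>t. t \<in> {0..1} \<Longrightarrow> (F has_real_derivative F' t) (at t within {0..1})"
    for F F' :: "real \<Rightarrow> real" and a b
  proof (rule mvt_very_simple[of a b F "\<lambda>t. (*) (F' t)"])
    fix s assume "a \<le> s" "s \<le> b"
    then show "(F has_derivative (*) (F' s)) (at s within {a..b})"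
      using that F[of s] has_derivative_subset[of F "(*) (F' s)" s "{0..1}" "{a..b}"]
      by (auto simp: has_field_derivative_def)
  qed (fact that)
  have "0 \<le> G' s * (s - x)" if s: "s \<in> {0..1}" for s
  proof (cases "x \<le> s")
    case True
    then obtain \<xi> where "\<xi> \<in> {x..s}" "G' s - G' x = G'' \<xi> * (s - x)"
      using mvt[OF _ x(1) s G'] by blast
    then show ?thesis using True nonneg[of \<xi>] x s by simp
  next
    case False
    then obtain \<xi> where "\<xi> \<in> {s..x}" "G' x - G' s = G'' \<xi> * (x - s)"
      using mvt[OF _ s x(1) G'] by force
    then have "G' s = G'' \<xi> * (s - x)"
      using x by (simp add: algebra_simps)
    then have "G' s * (s - x) = G'' \<xi> * (s - x)\<^sup>2"
      by (simp add: power2_eq_square)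
    then show ?thesis using nonneg[of \<xi>] \<open>\<xi> \<in> _\<close> x s by simp
  qed
  note slope = this
  show ?thesis
  proof (cases "x \<le> t")
    case True
    then obtain \<xi> where \<xi>: "\<xi> \<in> {x..t}" "G t - G x = G' \<xi> * (t - x)"
      using mvt[OF _ x(1) t G] by blast
    then have "0 \<le> G' \<xi> \<or> \<xi> = x" using slope[of \<xi>] x t by (auto simp: zero_le_mult_iff)
    then show ?thesis using \<xi> x True by auto
  next
    case False
    then obtain \<xi> where \<xi>: "\<xi> \<in> {t..x}" "G x - G t = G' \<xi> * (x - t)"
      using mvt[OF _ t x(1) G] by force
    then have "G' \<xi> \<le> 0 \<or> \<xi> = x" using slope[of \<xi>] x t by (auto simp: zero_le_mult_iff)
    then have "G' \<xi> * (x - t) \<le> 0" using x False by (auto intro: mult_nonpos_nonneg)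
    then show ?thesis using \<xi> x by simp
  qed
qed

text \<open>
  The remainder and its bound both have value and derivative zero at \<open>x\<close>, and the hypothesis on
  \<open>\<phi>\<close> is the inequality between their second derivatives. So the bound minus \<open>\<sigma>\<close> times the
  remainder is nonnegative for \<open>\<sigma> = 1\<close> and \<open>\<sigma> = -1\<close>.
\<close>

lemma taylor_remainder_quartic_bound:
  fixes f :: "real \<Rightarrow> real"
  assumes f: "\<And>t. t \<in> {0..1} \<Longrightarrow> (f has_real_derivative f' t) (at t within {0..1})"
    and f': "\<And>t. t \<in> {0..1} \<Longrightarrow> (f' has_real_derivative \<phi> t) (at t within {0..1})"
    and \<phi>: "\<And>t. t \<in> {0..1} \<Longrightarrow> \<bar>\<phi> t - \<phi> x - c * (t - x)\<bar> \<le> p + q * (t - x)\<^sup>2"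
    and x: "x \<in> {0..1}" and t: "t \<in> {0..1}"
  shows "\<bar>f t - (f x + f' x * (t - x) + \<phi> x / 2 * (t - x)^2 + c / 6 * (t - x)^3)\<bar>
           \<le> p / 2 * (t - x)^2 + q / 12 * (t - x)^4"
proof -
  have "0 \<le> (p / 2 * (t - x)^2 + q / 12 * (t - x)^4)
      - \<sigma> * (f t - (f x + f' x * (t - x) + \<phi> x / 2 * (t - x)^2 + c / 6 * (t - x)^3))"
    if \<sigma>: "\<sigma> = 1 \<or> \<sigma> = -1" for \<sigma> :: real
  proof (rule nonneg_of_second_derivative_nonneg[where
        G' = "\<lambda>t. (p * (t - x) + q / 3 * (t - x)^3)
          - \<sigma> * (f' t - (f' x + \<phi> x * (t - x) + c / 2 * (t - x)^2))" and
        G'' = "\<lambda>t. (p + q * (t - x)^2) - \<sigma> * (\<phi> t - (\<phi> x + c * (t - x)))", OF _ _ _ x _ _ t])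
    fix s :: real assume s: "s \<in> {0..1}"
    show "((\<lambda>t. (p / 2 * (t - x)^2 + q / 12 * (t - x)^4)
        - \<sigma> * (f t - (f x + f' x * (t - x) + \<phi> x / 2 * (t - x)^2 + c / 6 * (t - x)^3)))
        has_real_derivative (p * (s - x) + q / 3 * (s - x)^3)
          - \<sigma> * (f' s - (f' x + \<phi> x * (s - x) + c / 2 * (s - x)^2))) (at s within {0..1})"
      by (auto intro!: derivative_eq_intros f s simp: field_simps)
    show "((\<lambda>t. (p * (t - x) + q / 3 * (t - x)^3)
          - \<sigma> * (f' t - (f' x + \<phi> x * (t - x) + c / 2 * (t - x)^2)))
        has_real_derivative (p + q * (s - x)^2) - \<sigma> * (\<phi> s - (\<phi> x + c * (s - x))))
        (at s within {0..1})"
      by (auto intro!: derivative_eq_intros f' s simp: field_simps)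
    show "0 \<le> (p + q * (s - x)^2) - \<sigma> * (\<phi> s - (\<phi> x + c * (s - x)))"
      using \<phi>[OF s] \<sigma> by (auto simp: abs_le_iff)
  qed simp_all
  from this[of 1] this[of "-1"] show ?thesis by (simp add: abs_le_iff)
qed

text \<open>
  By monotonicity it suffices to evaluate the operator on the two quartics enclosing \<open>f\<close>.
\<close>

lemma kantorovich_quartic_approximation:
  fixes x a b c d p q :: real and n :: nat
  defines "X \<equiv> x * (1 - x)" and "N \<equiv> real n + 1"
  assumes cont: "continuous_on {0..1} f" and x: "x \<in> {0..1}"
    and f: "\<And>t. t \<in> {0..1} \<Longrightarrow> \<bar>f t - (a + b * (t - x) + c * (t - x)^2 + d * (t - x)^3)\<bar>
                                  \<le> p * (t - x)^2 + q * (t - x)^4"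
  shows "\<bar>kantorovich n f x - (a + b * ((1 - 2 * x) / (2 * N)) + c * (((real n - 1) * X + 1/3) / N^2)
             + d * ((1 - 2 * x) * (5/2 * real n * X + 1/4 - X/2) / N^3))\<bar>
         \<le> p * (((real n - 1) * X + 1/3) / N^2)
           + q * ((3 * (real n * X)\<^sup>2 + 5 * real n * X * (1 - 4 * X) + 1/5 - X + X\<^sup>2) / N^4)"
proof -
  let ?P = "\<lambda>p q t. a + b * (t - x) + (c + p) * (t - x)^2 + d * (t - x)^3 + q * (t - x)^4"
  have "kantorovich n f x \<le> kantorovich n (?P p q) x"
  proof (rule kantorovich_mono[OF cont _ _ x])
    fix t :: real assume "t \<in> {0..1}"
    then show "f t \<le> ?P p q t" using f[of t] by (simp add: algebra_simps abs_le_iff)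
  qed (intro continuous_intros)
  moreover have "kantorovich n (?P (- p) (- q)) x \<le> kantorovich n f x"
  proof (rule kantorovich_mono[OF _ cont _ x])
    fix t :: real assume "t \<in> {0..1}"
    then show "?P (- p) (- q) t \<le> f t" using f[of t] by (simp add: algebra_simps abs_le_iff)
  qed (intro continuous_intros)
  ultimately show ?thesis
    unfolding kantorovich_quartic X_def[symmetric] N_def[symmetric]
    by (simp only: abs_le_iff distrib_right minus_mult_left[symmetric]) linarith
qed

section \<open>The quantitative Voronovskaya estimate\<close>

text \<open>
  The error splits into the remainder \<open>R\<close>, which gives \<open>9/32 * \<omega>2\<close>, and the deviations \<open>T1\<close>,
  \<open>T2\<close>, \<open>T3\<close> of the first three moments from their limits.
\<close>

lemma kantorovich_voronovskaya_pointwise: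
  fixes n :: nat and f f' \<phi> :: "real \<Rightarrow> real" and x h :: real
  defines "N \<equiv> real n + 1" and "X \<equiv> x * (1 - x)"
  assumes h: "h = 1 / sqrt N"
    and f: "\<And>t. t \<in> {0..1} \<Longrightarrow> (f has_real_derivative f' t) (at t within {0..1})"
    and f': "\<And>t. t \<in> {0..1} \<Longrightarrow> (f' has_real_derivative \<phi> t) (at t within {0..1})"
    and \<phi>: "continuous_on {0..1} \<phi>" and x: "x \<in> {0..1}"
  shows "\<bar>real n * (kantorovich n f x - f x) - 1 / 2 * ((1 - 2 * x) * f' x + X * \<phi> x)\<bar>
     \<le> \<bar>f' x\<bar> / (2 * N) + \<bar>\<phi> x\<bar> / (2 * N)
       + 9 / 32 * (2 * h * modulus_of_smoothness 1 \<phi> h + modulus_of_smoothness 2 \<phi> h)"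
proof -
  define \<omega>1 \<omega>2 where "\<omega>1 = modulus_of_smoothness 1 \<phi> h" and "\<omega>2 = modulus_of_smoothness 2 \<phi> h"
  have N: "N \<ge> 1" "real n \<le> N" "0 \<le> real n" by (auto simp: N_def)
  have hN: "h > 0" "h\<^sup>2 = 1 / N" "h \<le> 1" using N by (auto simp: h power_divide)
  have \<omega>: "0 \<le> \<omega>1" "0 \<le> \<omega>2"
    using first_difference_le_modulus[OF \<phi> x x, of h]
      second_difference_le_modulus[OF \<phi>, of x 0 h] x hN by (auto simp: \<omega>1_def \<omega>2_def)
  \<comment> \<open>For \<open>n \<le> 2\<close> the step \<open>h\<close> exceeds \<open>1/2\<close>, and the secant point could fall outside \<open>{0..1}\<close>.\<close>
  define \<eta> where "\<eta> = min h (1/2)"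
  have \<eta>: "0 < \<eta>" "\<eta> \<le> 1/2" "\<eta> \<le> h" "h / 2 \<le> \<eta>" using hN by (auto simp: \<eta>_def)
  obtain c where c: "\<bar>c\<bar> \<le> \<omega>1 / \<eta>"
    and app: "\<And>t. t \<in> {0..1} \<Longrightarrow> \<bar>\<phi> t - \<phi> x - c * (t - x)\<bar>
           \<le> 3 / 2 * \<omega>2 * (1 + 3 * (t - x)\<^sup>2 / \<eta>\<^sup>2)"
    using affine_approximation_by_modulus[OF \<phi> x \<eta>(1-3)] unfolding \<omega>1_def \<omega>2_def by blast
  define m1 m2 m3 m4 where "m1 = (1 - 2 * x) / (2 * N)"
    and "m2 = ((real n - 1) * X + 1/3) / N^2"
    and "m3 = (1 - 2 * x) * (5/2 * real n * X + 1/4 - X/2) / N^3"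
    and "m4 = (3 * (real n * X)\<^sup>2 + 5 * real n * X * (1 - 4 * X) + 1/5 - X + X\<^sup>2) / N^4"
  have m2: "real n * m2 \<le> 1/4" "\<bar>real n * m2 - X\<bar> \<le> 1 / N"
    and m3: "\<bar>real n * m3\<bar> \<le> 1 / N" and m4: "real n * m4 \<le> real n / (4 * N^2)"
    using kantorovich_moment_bounds[OF x, of n]
    unfolding m2_def m3_def m4_def X_def N_def by blast+
  have "\<bar>kantorovich n f x - (f x + f' x * m1 + \<phi> x / 2 * m2 + c / 6 * m3)\<bar>
      \<le> (3 / 2 * \<omega>2) / 2 * m2 + (9 / 2 * \<omega>2 / \<eta>\<^sup>2) / 12 * m4"
    unfolding m1_def m2_def m3_def m4_def N_def X_def
  proof (rule kantorovich_quartic_approximation[OF _ x])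
    show "continuous_on {0..1} f" using f by (rule DERIV_continuous_on)
    fix t :: real assume t: "t \<in> {0..1}"
    show "\<bar>f t - (f x + f' x * (t - x) + \<phi> x / 2 * (t - x)^2 + c / 6 * (t - x)^3)\<bar>
        \<le> (3 / 2 * \<omega>2) / 2 * (t - x)^2 + (9 / 2 * \<omega>2 / \<eta>\<^sup>2) / 12 * (t - x)^4"
    proof (rule taylor_remainder_quartic_bound[OF f f' _ x t])
      show "\<bar>\<phi> t - \<phi> x - c * (t - x)\<bar> \<le> 3 / 2 * \<omega>2 + 9 / 2 * \<omega>2 / \<eta>\<^sup>2 * (t - x)\<^sup>2"
        if "t \<in> {0..1}" for t
        using app[OF that] by (simp add: algebra_simps)
    qed
  qed
  then have "real n * \<bar>kantorovich n f x - (f x + f' x * m1 + \<phi> x / 2 * m2 + c / 6 * m3)\<bar>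
      \<le> real n * ((3 / 2 * \<omega>2) / 2 * m2 + (9 / 2 * \<omega>2 / \<eta>\<^sup>2) / 12 * m4)"
    using N by (intro mult_left_mono)
  also have "\<dots> = 3 / 4 * \<omega>2 * (real n * m2) + 3 / 8 * \<omega>2 * (real n * m4 / \<eta>\<^sup>2)"
    by (simp add: algebra_simps)
  also have "\<dots> \<le> 3 / 4 * \<omega>2 * (1/4) + 3 / 8 * \<omega>2 * (1/4)"
  proof -
    have "real n * m4 / \<eta>\<^sup>2 \<le> (real n / (4 * N^2)) / \<eta>\<^sup>2"
      using m4 by (intro divide_right_mono) auto
    also have "\<dots> \<le> 1/4"
    proof (cases "h \<le> 1/2")
      case True
      then have "\<eta>\<^sup>2 = 1 / N" using hN by (simp add: \<eta>_def)
      then show ?thesis using N by (simp add: power2_eq_square divide_le_eq)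
    next
      case False
      then have "\<eta>\<^sup>2 = 1 / 4" by (simp add: \<eta>_def power2_eq_square)
      moreover have "4 * real n \<le> N\<^sup>2"
        using zero_le_power2[of "real n - 1"] by (simp add: N_def power2_eq_square algebra_simps)
      ultimately show ?thesis using N unfolding \<open>\<eta>\<^sup>2 = 1 / 4\<close> by (simp add: divide_le_eq)
    qed
    finally show ?thesis using m2(1) \<omega> by (intro add_mono mult_left_mono) auto
  qed
  finally have R: "\<bar>real n * (kantorovich n f x - (f x + f' x * m1 + \<phi> x / 2 * m2 + c / 6 * m3))\<bar>
      \<le> 9 / 32 * \<omega>2" using N by (simp add: abs_mult)
  have T1: "\<bar>f' x * (real n * m1 - (1 - 2 * x) / 2)\<bar> \<le> \<bar>f' x\<bar> * (1 / (2 * N))"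
  proof -
    have "real n * m1 - (1 - 2 * x) / 2 = - (1 - 2 * x) / (2 * N)"
      using N(1) unfolding m1_def by (simp add: field_simps) (simp add: N_def algebra_simps)
    also have "\<bar>\<dots>\<bar> = \<bar>1 - 2 * x\<bar> / (2 * N)" using N by simp
    also have "\<dots> \<le> 1 / (2 * N)" using x N by (intro divide_right_mono) (auto simp: abs_le_iff)
    finally show ?thesis unfolding abs_mult by (rule mult_left_mono) simp
  qed
  have T2: "\<bar>\<phi> x / 2 * (real n * m2 - X)\<bar> \<le> \<bar>\<phi> x\<bar> / 2 * (1 / N)"
    unfolding abs_mult using m2(2) by (intro mult_mono) auto
  have T3: "\<bar>c / 6 * (real n * m3)\<bar> \<le> 9 / 16 * (h * \<omega>1)"
  proof -
    have "\<bar>c / 6 * (real n * m3)\<bar> \<le> (\<omega>1 / \<eta>) / 6 * (1 / N)"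
      unfolding abs_mult using m3 c \<omega> \<eta> by (intro mult_mono) auto
    also have "\<dots> = \<omega>1 / 6 * (h\<^sup>2 / \<eta>)" by (simp add: hN)
    also have "\<dots> \<le> \<omega>1 / 6 * (2 * h)"
    proof (rule mult_left_mono)
      have "h * h \<le> 2 * h * \<eta>" using \<eta>(4) hN(1) mult_left_mono[of h "2 * \<eta>" h] by simp
      then show "h\<^sup>2 / \<eta> \<le> 2 * h" using \<eta>(1) by (simp add: divide_le_eq power2_eq_square)
    qed (use \<omega> in simp)
    also have "\<dots> = 1 / 3 * (h * \<omega>1)" by simp
    also have "\<dots> \<le> 9 / 16 * (h * \<omega>1)" using \<omega> hN by (intro mult_right_mono) auto
    finally show ?thesis .
  qed
  have "real n * (kantorovich n f x - f x) - 1 / 2 * ((1 - 2 * x) * f' x + X * \<phi> x)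
      = real n * (kantorovich n f x - (f x + f' x * m1 + \<phi> x / 2 * m2 + c / 6 * m3))
        + f' x * (real n * m1 - (1 - 2 * x) / 2) + \<phi> x / 2 * (real n * m2 - X)
        + c / 6 * (real n * m3)"
    by (simp add: field_simps)
  also have "\<bar>\<dots>\<bar> \<le> 9 / 32 * \<omega>2 + \<bar>f' x\<bar> * (1 / (2 * N)) + \<bar>\<phi> x\<bar> / 2 * (1 / N)
      + 9 / 16 * (h * \<omega>1)"
    using R T1 T2 T3 by linarith
  finally show ?thesis unfolding \<omega>1_def \<omega>2_def by (simp add: algebra_simps)
qed

theorem theorem3p1:
  fixes n :: nat and f X :: "real \<Rightarrow> real"
  defines "X \<equiv> \<lambda>x. x * (1 - x)"
  assumes "n \<ge> 1" and "C2_01 f"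
  shows "sup_norm01 (\<lambda>x. real n * (kantorovich n f x - f x)
            - 1 / 2 * deriv01 (\<lambda>y. X y * deriv01 f y) x)
       \<le> 2 / (3 * (real n + 1)) *
            (3 / 4 * sup_norm01 (deriv01 f) + sup_norm01 (deriv01 (deriv01 f)))
         + 9 / 32 *
            (2 / sqrt (real n + 1)
               * modulus_of_smoothness 1 (deriv01 (deriv01 f)) (1 / sqrt (real n + 1))
             + modulus_of_smoothness 2 (deriv01 (deriv01 f)) (1 / sqrt (real n + 1)))"
proof -
  define f' \<phi> where "f' = deriv01 f" and "\<phi> = deriv01 f'"
  have f: "(f has_real_derivative f' t) (at t within {0..1})"
    and f': "(f' has_real_derivative \<phi> t) (at t within {0..1})" if "t \<in> {0..1}" for t
    using assms(3) that unfolding C2_01_def f'_def \<phi>_def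
    by (auto intro: has_real_derivative_deriv01)
  have \<phi>: "continuous_on {0..1} \<phi>"
    using assms(3) by (simp add: C2_01_def f'_def \<phi>_def)
  have f'_cont: "continuous_on {0..1} f'"
    using f' by (rule DERIV_continuous_on)
  show ?thesis
    unfolding f'_def[symmetric] \<phi>_def[symmetric] sup_norm01_def[of "\<lambda>x. real n * _ x - _ x"]
  proof (rule cSUP_least)
    fix x :: real assume x: "x \<in> {0..1}"
    have D: "deriv01 (\<lambda>y. X y * f' y) x = (1 - 2 * x) * f' x + X x * \<phi> x"
      unfolding X_def using x
      by (intro deriv01_eqI) (auto intro!: derivative_eq_intros f' simp: algebra_simps)
    have "\<bar>real n * (kantorovich n f x - f x) - 1 / 2 * deriv01 (\<lambda>y. X y * f' y) x\<bar>
      \<le> \<bar>f' x\<bar> / (2 * (real n + 1)) + \<bar>\<phi> x\<bar> / (2 * (real n + 1))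
       + 9 / 32 * (2 * (1 / sqrt (real n + 1)) * modulus_of_smoothness 1 \<phi> (1 / sqrt (real n + 1))
           + modulus_of_smoothness 2 \<phi> (1 / sqrt (real n + 1)))"
      unfolding D unfolding X_def
      by (rule kantorovich_voronovskaya_pointwise[OF refl f f' \<phi> x])
    also have "\<bar>f' x\<bar> / (2 * (real n + 1)) + \<bar>\<phi> x\<bar> / (2 * (real n + 1))
        \<le> 2 / (3 * (real n + 1)) * (3 / 4 * sup_norm01 f' + sup_norm01 \<phi>)"
    proof -
      have "\<bar>f' x\<bar> / (2 * (real n + 1)) + \<bar>\<phi> x\<bar> / (2 * (real n + 1))
          = (\<bar>f' x\<bar> / 2 + \<bar>\<phi> x\<bar> / 2) / (real n + 1)"
        by (simp only: add_divide_distrib divide_divide_eq_left)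
      also have "\<dots> \<le> (2 / 3 * (3 / 4 * sup_norm01 f' + sup_norm01 \<phi>)) / (real n + 1)"
        using abs_le_sup_norm01[OF f'_cont x] abs_le_sup_norm01[OF \<phi> x]
        by (intro divide_right_mono) simp_all
      also have "\<dots> = 2 / (3 * (real n + 1)) * (3 / 4 * sup_norm01 f' + sup_norm01 \<phi>)"
        by (simp only: times_divide_eq_left divide_divide_eq_left)
      finally show ?thesis .
    qed
    finally show "\<bar>real n * (kantorovich n f x - f x) - 1 / 2 * deriv01 (\<lambda>y. X y * f' y) x\<bar>
      \<le> 2 / (3 * (real n + 1)) * (3 / 4 * sup_norm01 f' + sup_norm01 \<phi>)
       + 9 / 32 * (2 / sqrt (real n + 1) * modulus_of_smoothness 1 \<phi> (1 / sqrt (real n + 1))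
           + modulus_of_smoothness 2 \<phi> (1 / sqrt (real n + 1)))"
      by simp
  qed simp
qed

end
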